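(* Let $\Psi$ be an orthonormal basis for $\mathbb{R}^N$. Let $\Omega\subset\{1,\dots,N\}$ with $|\Omega|=K$ be a fixed common support, and let the signals be $x_j=\Psi\vartheta_j$, $j=1,\dots,J$, where each $\vartheta_j\in\mathbb{R}^N$ is supported on $\Omega$ and the coefficients $\vartheta_j(n)$, $n\in\Omega$, $1\le j\le J$, are i.i.d. Gaussian random variables. Let the $M\times N$ measurement matrices $\Phi_j$ contain i.i.d. Gaussian entries, and let $y_j=\Phi_jx_j$. Then, for any fixed number $M\ge1$ of measurements per signal, the Trivial Pursuit algorithm recovers $\Omega$ (i.e., its output $\widehat\Omega$ equals $\Omega$) with probability approaching one as $J\to\infty$.
   Context: This is the JSM-2 (common sparse supports) model: all signals share the same support in the basis $\Psi$ but have different nonzero coefficients. $N$, $K$, $M$ are fixed as $J\to\infty$. Trivial Pursuit (TP): let $\phi_{j,n}$ be the $n$-th column of $\Phi_j\Psi$. Compute $$\xi_n=\frac1J\sum_{j=1}^J\langle y_j,\phi_{j,n}\rangle^2,\qquad n\in\{1,\dots,N\},$$ and let $\widehat\Omega$ be the set of indices $n$ having one of the $K$ largest values $\xi_n$. Gaussian variables are zero-mean with positive variance (with a common variance for all coefficients, and a common variance for all matrix entries); the matrices $\Phi_j$ are independent across $j$ and independent of the signals. *)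

theory Defs
  imports "HOL-Probability.Probability"
begin

definition orthonormal_basis_matrix :: "real ^ 'n ^ 'n \<Rightarrow> bool" where
  "orthonormal_basis_matrix \<Psi> \<longleftrightarrow>
     (\<forall>i k. column i \<Psi> \<bullet> column k \<Psi> = (if i = k then 1 else 0)) \<and>
     span (columns \<Psi>) = UNIV"

definition tp_statistic ::
    "nat \<Rightarrow> (nat \<Rightarrow> real ^ 'm) \<Rightarrow> (nat \<Rightarrow> real ^ 'n ^ 'm) \<Rightarrow> real ^ 'n ^ 'n \<Rightarrow> 'n \<Rightarrow> real" where
  "tp_statistic J y \<Phi> \<Psi> n = (1 / real J) * (\<Sum>j=1..J. (y j \<bullet> column n (\<Phi> j ** \<Psi>))\<^sup>2)"

(* An index is selected when fewer than K indices have a strictly larger statistic.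
   Ties at the K-th place are all kept, so the output can have more than K elements;
   it equals a set of size K only if that set is the unambiguous choice of K largest values. *)
definition trivial_pursuit ::
    "nat \<Rightarrow> nat \<Rightarrow> (nat \<Rightarrow> real ^ 'm) \<Rightarrow> (nat \<Rightarrow> real ^ 'n ^ 'm) \<Rightarrow> real ^ 'n ^ 'n \<Rightarrow> 'n set" where
  "trivial_pursuit K J y \<Phi> \<Psi> =
     {n. card {k. tp_statistic J y \<Phi> \<Psi> k > tp_statistic J y \<Phi> \<Psi> n} < K}"

end

theory Submission
  imports Defs
begin

text \<open>
  The columns of \<open>\<Phi>\<^sub>j \<Psi>\<close> satisfy \<open>E \<langle>a\<^sub>l, a\<^sub>n\<rangle>\<^sup>2 = \<tau>\<^sup>4 (M + [l = n] M (M + 1))\<close>: the fourth-order Wick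
  formula reduces this to the orthonormality of \<open>\<Psi>\<close>. Since the coefficients are uncorrelated
  and independent of the matrices, each summand of \<open>\<xi>\<^sub>n\<close> has mean
  \<open>\<sigma>\<^sup>2 \<tau>\<^sup>4 (M K + [n \<in> \<Omega>] M (M + 1))\<close>. The summands are independent and identically distributed
  over \<open>j\<close> with finite moments, so by the weak law every \<open>\<xi>\<^sub>n\<close> is within half the gap
  \<open>\<sigma>\<^sup>2 \<tau>\<^sup>4 M (M + 1)\<close> of its mean with probability tending to one, and then the \<open>K\<close> largest
  values are exactly those indexed by \<open>\<Omega>\<close>.
\<close>

section \<open>Random variables with finite moments of every order\<close>

text \<open>A class closed under sums and products, so that every polynomial in Gaussian variables
  is integrable without a separate estimate. Plain powers suffice in place of absolute moments,
  because the even ones control the rest.\<close>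

definition all_moments :: "'a measure \<Rightarrow> ('a \<Rightarrow> real) \<Rightarrow> bool" where
  "all_moments M f \<longleftrightarrow> (\<forall>k. integrable M (\<lambda>\<omega>. f \<omega> ^ k))"

lemma all_moments_measurable: "all_moments M f \<Longrightarrow> f \<in> borel_measurable M"
  unfolding all_moments_def by (drule spec[of _ 1]) (auto dest: borel_measurable_integrable)

lemma all_moments_integrable: "all_moments M f \<Longrightarrow> integrable M f"
  unfolding all_moments_def by (drule spec[of _ 1]) auto

lemma all_moments_power:
  assumes "all_moments M f"
  shows "all_moments M (\<lambda>\<omega>. f \<omega> ^ k)"
  using assms unfolding all_moments_def by (simp flip: power_mult)

text \<open>From (|a| - |b|)^2 >= 0 one gets |a b| <= a^2 + b^2. With a, b the k-th powers of the
  factors, the even moments of order 2k dominate the k-th power of the product; the factors may be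
  dependent.\<close>

lemma all_moments_mult:
  assumes "all_moments M f" "all_moments M g"
  shows "all_moments M (\<lambda>\<omega>. f \<omega> * g \<omega>)"
  unfolding all_moments_def
proof
  fix k
  note [measurable] = assms[THEN all_moments_measurable]
  have "integrable M (\<lambda>\<omega>. f \<omega> ^ (2 * k) + g \<omega> ^ (2 * k))"
    using assms by (auto simp: all_moments_def)
  then show "integrable M (\<lambda>\<omega>. (f \<omega> * g \<omega>) ^ k)"
  proof (rule Bochner_Integration.integrable_bound)
    show "AE \<omega> in M. norm ((f \<omega> * g \<omega>) ^ k) \<le> norm (f \<omega> ^ (2 * k) + g \<omega> ^ (2 * k))"
    proof (rule AE_I2)
      fix \<omega>
      let ?a = "f \<omega> ^ k" and ?b = "g \<omega> ^ k"
      have "0 \<le> (\<bar>?a\<bar> - \<bar>?b\<bar>)\<^sup>2" "0 \<le> ?a\<^sup>2" "0 \<le> ?b\<^sup>2"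
        by auto
      then have "\<bar>?a * ?b\<bar> \<le> ?a\<^sup>2 + ?b\<^sup>2"
        unfolding power2_diff abs_mult power2_abs by linarith
      then show "norm ((f \<omega> * g \<omega>) ^ k) \<le> norm (f \<omega> ^ (2 * k) + g \<omega> ^ (2 * k))"
        by (simp add: power_mult_distrib power_mult mult.commute[of 2 k])
    qed
  qed measurable
qed

lemma all_moments_add:
  assumes "all_moments M f" "all_moments M g"
  shows "all_moments M (\<lambda>\<omega>. f \<omega> + g \<omega>)"
  unfolding all_moments_def binomial_ring
  using all_moments_mult[OF all_moments_power[OF assms(1)] all_moments_power[OF assms(2)]]
  by (auto intro!: Bochner_Integration.integrable_sum integrable_mult_right
      dest: all_moments_integrable simp: mult.assoc)

lemma (in finite_measure) all_moments_const: "all_moments M (\<lambda>_. c)"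
  by (auto simp: all_moments_def)

lemma (in finite_measure) all_moments_cmult: "all_moments M f \<Longrightarrow> all_moments M (\<lambda>\<omega>. c * f \<omega>)"
  by (rule all_moments_mult[OF all_moments_const])

lemma (in finite_measure) all_moments_sum:
  assumes "\<And>i. i \<in> I \<Longrightarrow> all_moments M (f i)"
  shows "all_moments M (\<lambda>\<omega>. \<Sum>i\<in>I. f i \<omega>)"
  using assms
  by (induction I rule: infinite_finite_induct) (auto intro: all_moments_const all_moments_add)

section \<open>Moments of Gaussian variables and of independent sums\<close>

lemma (in prob_space) normal_all_moments:
  assumes "\<sigma> > 0" "distributed M lborel f (\<lambda>t. ennreal (normal_density 0 \<sigma> t))"
  shows "all_moments M f"
  unfolding all_moments_def
proof
  fix k
  show "integrable M (\<lambda>\<omega>. f \<omega> ^ k)"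
    using distributed_integrable[OF assms(2), of "\<lambda>t. t ^ k"] integrable_normal_moment[OF assms(1), of 0 k]
    by simp
qed

text \<open>The fourth moment is written as three times the squared variance, the shape that
  \<open>gaussian_type_sum_moment4\<close> propagates through sums.\<close>

lemma (in prob_space) normal_moments:
  assumes "\<sigma> > 0" "distributed M lborel f (\<lambda>t. ennreal (normal_density 0 \<sigma> t))"
  shows "expectation f = 0" "expectation (\<lambda>\<omega>. f \<omega> ^ 2) = \<sigma>\<^sup>2"
    "expectation (\<lambda>\<omega>. f \<omega> ^ 3) = 0" "expectation (\<lambda>\<omega>. f \<omega> ^ 4) = 3 * (\<sigma>\<^sup>2)\<^sup>2"
proof -
  have *: "expectation (\<lambda>\<omega>. f \<omega> ^ k) = (\<integral>t. normal_density 0 \<sigma> t * (t - 0) ^ k \<partial>lborel)" for k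
    using distributed_integral[OF assms(2), of "\<lambda>t. t ^ k"] by simp
  show "expectation f = 0"
    using *[of 1] integral_normal_moment_odd[OF assms(1), of 0 0] by simp
  show "expectation (\<lambda>\<omega>. f \<omega> ^ 2) = \<sigma>\<^sup>2"
    using *[of 2] integral_normal_moment_even[OF assms(1), of 0 1] by (simp add: fact_numeral)
  show "expectation (\<lambda>\<omega>. f \<omega> ^ 3) = 0"
    using *[of 3] integral_normal_moment_odd[OF assms(1), of 0 1] by simp
  show "expectation (\<lambda>\<omega>. f \<omega> ^ 4) = 3 * (\<sigma>\<^sup>2)\<^sup>2"
    using *[of 4] integral_normal_moment_even[OF assms(1), of 0 2]
    by (simp add: fact_numeral power_divide)
qed

lemma (in prob_space) expectation_power_mult_indep:
  fixes f g :: "'a \<Rightarrow> real"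
  assumes "indep_var borel f borel g" "all_moments M f" "all_moments M g"
  shows "expectation (\<lambda>\<omega>. f \<omega> ^ a * g \<omega> ^ b) =
    expectation (\<lambda>\<omega>. f \<omega> ^ a) * expectation (\<lambda>\<omega>. g \<omega> ^ b)"
proof (rule indep_var_lebesgue_integral)
  show "indep_var borel (\<lambda>\<omega>. f \<omega> ^ a) borel (\<lambda>\<omega>. g \<omega> ^ b)"
    using indep_var_compose[OF assms(1), of "\<lambda>t. t ^ a" borel "\<lambda>t. t ^ b" borel]
    by (simp add: comp_def)
qed (use assms in \<open>auto simp: all_moments_def\<close>)

text \<open>Each new summand is independent of the sum of the others, so the cross term factors and
  vanishes with the mean of the summand.\<close>

lemma (in prob_space) indep_centered_sum_square:
  fixes X :: "'i \<Rightarrow> 'a \<Rightarrow> real"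
  assumes "finite I" "indep_vars (\<lambda>_. borel) X I"
    and "\<And>i. i \<in> I \<Longrightarrow> all_moments M (X i)"
    and "\<And>i. i \<in> I \<Longrightarrow> expectation (X i) = 0"
  shows "expectation (\<lambda>\<omega>. (\<Sum>i\<in>I. X i \<omega>) ^ 2) = (\<Sum>i\<in>I. expectation (\<lambda>\<omega>. X i \<omega> ^ 2))"
  using assms
proof (induction I rule: finite_induct)
  case empty
  then show ?case by simp
next
  case (insert i I)
  let ?S = "\<lambda>\<omega>. \<Sum>i\<in>I. X i \<omega>"
  have IH: "expectation (\<lambda>\<omega>. ?S \<omega> ^ 2) = (\<Sum>i\<in>I. expectation (\<lambda>\<omega>. X i \<omega> ^ 2))"
    using insert.IH[OF indep_vars_subset[OF insert.prems(1)]] insert.prems by auto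
  have ind: "indep_var borel (X i) borel ?S"
    by (rule indep_vars_sum[OF insert.hyps insert.prems(1)])
  have mom: "all_moments M (X i)" "all_moments M ?S"
    using insert.prems by (auto intro: all_moments_sum)
  have cross: "expectation (\<lambda>\<omega>. X i \<omega> * ?S \<omega>) = 0"
    using expectation_power_mult_indep[OF ind mom, of 1 1] insert.prems by simp
  have int: "integrable M (\<lambda>\<omega>. X i \<omega> ^ 2)" "integrable M (\<lambda>\<omega>. ?S \<omega> ^ 2)" "integrable M (\<lambda>\<omega>. X i \<omega> * ?S \<omega>)"
    using mom by (auto intro!: all_moments_integrable all_moments_mult all_moments_power)
  have "expectation (\<lambda>\<omega>. (\<Sum>i\<in>insert i I. X i \<omega>) ^ 2) =
      expectation (\<lambda>\<omega>. X i \<omega> ^ 2 + 2 * (X i \<omega> * ?S \<omega>) + ?S \<omega> ^ 2)"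
    using insert.hyps by (simp add: power2_sum algebra_simps)
  then show ?case
    using insert.hyps int cross IH by simp
qed

text \<open>Vanishing odd moments and \<open>E X\<^sup>4 = 3 (E X\<^sup>2)\<^sup>2\<close> survive independent sums, which
  gives the fourth moments of linear forms without identifying their law.\<close>
lemma (in prob_space) gaussian_type_sum_moment4:
  fixes X :: "'i \<Rightarrow> 'a \<Rightarrow> real"
  assumes "finite I" "indep_vars (\<lambda>_. borel) X I"
    and "\<And>i. i \<in> I \<Longrightarrow> all_moments M (X i)"
    and "\<And>i. i \<in> I \<Longrightarrow> expectation (X i) = 0"
    and "\<And>i. i \<in> I \<Longrightarrow> expectation (\<lambda>\<omega>. X i \<omega> ^ 3) = 0"
    and "\<And>i. i \<in> I \<Longrightarrow> expectation (\<lambda>\<omega>. X i \<omega> ^ 4) = 3 * (expectation (\<lambda>\<omega>. X i \<omega> ^ 2))\<^sup>2"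
  shows "expectation (\<lambda>\<omega>. (\<Sum>i\<in>I. X i \<omega>) ^ 4) = 3 * (\<Sum>i\<in>I. expectation (\<lambda>\<omega>. X i \<omega> ^ 2))\<^sup>2"
  using assms
proof (induction I rule: finite_induct)
  case empty
  then show ?case by simp
next
  case (insert i I)
  let ?S = "\<lambda>\<omega>. \<Sum>i\<in>I. X i \<omega>"
  have indI: "indep_vars (\<lambda>_. borel) X I"
    by (rule indep_vars_subset[OF insert.prems(1)]) auto
  have IH: "expectation (\<lambda>\<omega>. ?S \<omega> ^ 4) = 3 * (\<Sum>i\<in>I. expectation (\<lambda>\<omega>. X i \<omega> ^ 2))\<^sup>2"
    using insert.IH[OF indI] insert.prems by auto
  have S2: "expectation (\<lambda>\<omega>. ?S \<omega> ^ 2) = (\<Sum>i\<in>I. expectation (\<lambda>\<omega>. X i \<omega> ^ 2))"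
    using insert.prems insert.hyps by (intro indep_centered_sum_square indI) auto
  have S1: "expectation ?S = 0"
    using insert.prems by (subst Bochner_Integration.integral_sum) (auto dest: all_moments_integrable)
  have ind: "indep_var borel (X i) borel ?S"
    by (rule indep_vars_sum[OF insert.hyps insert.prems(1)])
  have mom: "all_moments M (X i)" "all_moments M ?S"
    using insert.prems by (auto intro: all_moments_sum)
  have m: "expectation (X i) = 0" "expectation (\<lambda>\<omega>. X i \<omega> ^ 3) = 0"
    "expectation (\<lambda>\<omega>. X i \<omega> ^ 4) = 3 * (expectation (\<lambda>\<omega>. X i \<omega> ^ 2))\<^sup>2"
    using insert.prems by auto
  \<comment> \<open>Each of these products factors through an odd moment of \<open>X i\<close>,
    which is zero.\<close>
  have cross: "expectation (\<lambda>\<omega>. X i \<omega> ^ 3 * ?S \<omega>) = 0" "expectation (\<lambda>\<omega>. X i \<omega> * ?S \<omega> ^ 3) = 0"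
    using expectation_power_mult_indep[OF ind mom, of 3 1] expectation_power_mult_indep[OF ind mom, of 1 3]
    by (simp_all add: m S1)
  have int: "integrable M (\<lambda>\<omega>. X i \<omega> ^ 2 * ?S \<omega> ^ 2)" "integrable M (\<lambda>\<omega>. X i \<omega> ^ 3 * ?S \<omega>)"
    "integrable M (\<lambda>\<omega>. X i \<omega> * ?S \<omega> ^ 3)" "integrable M (\<lambda>\<omega>. X i \<omega> ^ 4)" "integrable M (\<lambda>\<omega>. ?S \<omega> ^ 4)"
    using mom by (auto intro!: all_moments_integrable all_moments_mult all_moments_power)
  have "expectation (\<lambda>\<omega>. (\<Sum>i\<in>insert i I. X i \<omega>) ^ 4) =
      expectation (\<lambda>\<omega>. X i \<omega> ^ 4 + 4 * (X i \<omega> ^ 3 * ?S \<omega>) + 6 * (X i \<omega> ^ 2 * ?S \<omega> ^ 2)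
        + 4 * (X i \<omega> * ?S \<omega> ^ 3) + ?S \<omega> ^ 4)"
    using insert.hyps by (simp add: eval_nat_numeral algebra_simps)
  also have "\<dots> = 3 * (expectation (\<lambda>\<omega>. X i \<omega> ^ 2))\<^sup>2
      + 6 * (expectation (\<lambda>\<omega>. X i \<omega> ^ 2) * expectation (\<lambda>\<omega>. ?S \<omega> ^ 2)) + expectation (\<lambda>\<omega>. ?S \<omega> ^ 4)"
    using int cross m expectation_power_mult_indep[OF ind mom, of 2 2] by simp
  \<comment> \<open>With a and b the second moments of \<open>X i\<close> and of the remaining sum,
    3 a^2 + 6 a b + 3 b^2 = 3 (a + b)^2.\<close>
  also have "\<dots> = 3 * (\<Sum>i\<in>insert i I. expectation (\<lambda>\<omega>. X i \<omega> ^ 2))\<^sup>2"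
    unfolding IH S2 using insert.hyps by (simp add: power2_sum algebra_simps)
  finally show ?case .
qed

section \<open>Wick's formula of order four\<close>

text \<open>Both sides are symmetric and multilinear in the four coefficient vectors, so they are
  determined by their values when all four coincide; there \<open>L4\<close> gives 3 \<tau>^4
  \<open>(ip u u)^2\<close>.\<close>

lemma (in prob_space) gaussian_wick4:
  fixes I :: "'i set" and g :: "'i \<Rightarrow> 'a \<Rightarrow> real" and u v w z :: "'i \<Rightarrow> real" and \<tau> :: real
  defines "L \<equiv> \<lambda>u \<omega>. \<Sum>i\<in>I. u i * g i \<omega>"
    and "ip \<equiv> \<lambda>u v. \<Sum>i\<in>I. u i * v i"
  assumes "finite I" "indep_vars (\<lambda>_. borel) g I" "\<tau> > 0"
    and g: "\<And>i. i \<in> I \<Longrightarrow> distributed M lborel (g i) (\<lambda>t. ennreal (normal_density 0 \<tau> t))"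
  shows "expectation (\<lambda>\<omega>. L u \<omega> * L v \<omega> * L w \<omega> * L z \<omega>) =
    \<tau> ^ 4 * (ip u v * ip w z + ip u w * ip v z + ip u z * ip v w)"
proof -
  have mom: "all_moments M (L u)" for u
    unfolding L_def using normal_all_moments[OF \<open>\<tau> > 0\<close> g]
    by (intro all_moments_sum all_moments_cmult)
  have L4: "expectation (\<lambda>\<omega>. L u \<omega> ^ 4) = 3 * \<tau> ^ 4 * (ip u u)\<^sup>2" for u
  proof -
    have "expectation (\<lambda>\<omega>. (\<Sum>i\<in>I. u i * g i \<omega>) ^ 4) =
        3 * (\<Sum>i\<in>I. expectation (\<lambda>\<omega>. (u i * g i \<omega>) ^ 2))\<^sup>2"
    proof (intro gaussian_type_sum_moment4)
      show "indep_vars (\<lambda>_. borel) (\<lambda>i \<omega>. u i * g i \<omega>) I"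
        by (rule indep_vars_compose2[OF assms(4)]) auto
    qed (use assms normal_moments[OF \<open>\<tau> > 0\<close> g] normal_all_moments[OF \<open>\<tau> > 0\<close> g]
        in \<open>auto intro!: all_moments_cmult simp: power_mult_distrib\<close>)
    also have "(\<Sum>i\<in>I. expectation (\<lambda>\<omega>. (u i * g i \<omega>) ^ 2)) = \<tau>\<^sup>2 * ip u u"
      unfolding ip_def sum_distrib_left
      by (intro sum.cong) (auto simp: power_mult_distrib normal_moments[OF \<open>\<tau> > 0\<close> g] mult.commute
          simp flip: power2_eq_square)
    finally show ?thesis
      by (simp add: L_def power_mult_distrib flip: power_mult)
  qed
  \<comment> \<open>Polarization: the multilinear moment is a signed sum of fourth powers of linear forms.\<close>
  let ?c = "\<lambda>a b c i. u i + a * v i + b * w i + c * z i :: real"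
  have L_add: "L (?c a b c) \<omega> = L u \<omega> + a * L v \<omega> + b * L w \<omega> + c * L z \<omega>" for a b c \<omega>
    unfolding L_def by (simp add: sum.distrib sum_distrib_left algebra_simps)
  have ip_add: "ip (?c a b c) (?c a b c) = ip u u + a\<^sup>2 * ip v v + b\<^sup>2 * ip w w + c\<^sup>2 * ip z z +
      2 * (a * ip u v + b * ip u w + c * ip u z + a * b * ip v w + a * c * ip v z + b * c * ip w z)"
    for a b c
    unfolding ip_def by (simp add: sum.distrib sum_distrib_left algebra_simps power2_eq_square)
  have int: "integrable M (\<lambda>\<omega>. L u \<omega> ^ 4)" for u
    using mom by (simp add: all_moments_def)
  let ?F = "\<lambda>a b c \<omega>. L (?c a b c) \<omega> ^ 4"
  \<comment> \<open>Each fourth power is weighted by the product of its three signs. Only monomials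
    odd in each of v, w, z survive; in degree four that leaves u v w z, with coefficient 4! in each
    of the 8 terms, and 24 * 8 = 192.\<close>
  have "192 * (L u \<omega> * L v \<omega> * L w \<omega> * L z \<omega>) =
      ?F 1 1 1 \<omega> - ?F 1 1 (-1) \<omega> - ?F 1 (-1) 1 \<omega> - ?F (-1) 1 1 \<omega>
      + ?F 1 (-1) (-1) \<omega> + ?F (-1) 1 (-1) \<omega> + ?F (-1) (-1) 1 \<omega> - ?F (-1) (-1) (-1) \<omega>" for \<omega>
    unfolding L_add by (simp add: power4_eq_xxxx) algebra
  then have "192 * expectation (\<lambda>\<omega>. L u \<omega> * L v \<omega> * L w \<omega> * L z \<omega>) =
      expectation (\<lambda>\<omega>. ?F 1 1 1 \<omega> - ?F 1 1 (-1) \<omega> - ?F 1 (-1) 1 \<omega> - ?F (-1) 1 1 \<omega>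
      + ?F 1 (-1) (-1) \<omega> + ?F (-1) 1 (-1) \<omega> + ?F (-1) (-1) 1 \<omega> - ?F (-1) (-1) (-1) \<omega>)"
    by (simp flip: integral_mult_right_zero)
  \<comment> \<open>In the square of \<open>ip_add\<close> the same signs keep the products of
    complementary pairings, each with coefficient 8. The 8 sign patterns and the factor 3 of
    \<open>L4\<close> again give 192.\<close>
  also have "\<dots> = 192 * (\<tau> ^ 4 * (ip u v * ip w z + ip u w * ip v z + ip u z * ip v w))"
    by (simp only: Bochner_Integration.integral_diff Bochner_Integration.integral_add
        Bochner_Integration.integrable_diff Bochner_Integration.integrable_add int L4 ip_add)
      (simp add: power2_eq_square algebra_simps)
  finally show ?thesis by simp
qed

section \<open>Weak law of large numbers\<close>

text \<open>Chebyshev's inequality: by independence the variance of the average is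
  \<open>(V - \<mu>^2) / J\<close>. A common mean and second moment are all that is asked of the
  laws beyond finite moments.\<close>

lemma (in prob_space) weak_law_of_large_numbers:
  fixes Z :: "nat \<Rightarrow> 'a \<Rightarrow> real"
  assumes "indep_vars (\<lambda>_. borel) Z {1..}"
    and mom: "\<And>j. j \<ge> 1 \<Longrightarrow> all_moments M (Z j)"
    and mean: "\<And>j. j \<ge> 1 \<Longrightarrow> expectation (Z j) = \<mu>"
    and second: "\<And>j. j \<ge> 1 \<Longrightarrow> expectation (\<lambda>\<omega>. (Z j \<omega>)\<^sup>2) = V"
    and "\<epsilon> > 0"
  shows "(\<lambda>J. prob {\<omega> \<in> space M. \<epsilon> \<le> \<bar>1 / real J * (\<Sum>j=1..J. Z j \<omega>) - \<mu>\<bar>}) \<longlonglongrightarrow> 0"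
proof (rule tendsto_sandwich[OF _ _ tendsto_const])
  show "\<forall>\<^sub>F J in sequentially. 0 \<le> prob {\<omega> \<in> space M. \<epsilon> \<le> \<bar>1 / real J * (\<Sum>j=1..J. Z j \<omega>) - \<mu>\<bar>}"
    by simp
  show "(\<lambda>J. (V - \<mu>\<^sup>2) / \<epsilon>\<^sup>2 / real J) \<longlonglongrightarrow> 0"
    by (rule lim_const_over_n)
  show "\<forall>\<^sub>F J in sequentially. prob {\<omega> \<in> space M. \<epsilon> \<le> \<bar>1 / real J * (\<Sum>j=1..J. Z j \<omega>) - \<mu>\<bar>}
      \<le> (V - \<mu>\<^sup>2) / \<epsilon>\<^sup>2 / real J"
    \<comment> \<open>For J = 0 the average is 0 by the convention 1 / 0 = 0; its mean is \<mu> from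
      J = 1 on.\<close>
    using eventually_ge_at_top[of 1]
  proof eventually_elim
    case (elim J)
    let ?A = "\<lambda>\<omega>. 1 / real J * (\<Sum>j=1..J. Z j \<omega>)"
    have momA: "all_moments M ?A"
      using mom by (intro all_moments_cmult all_moments_sum) auto
    have int: "integrable M (Z j)" "integrable M (\<lambda>\<omega>. (Z j \<omega>)\<^sup>2)" if "j \<ge> 1" for j
      using mom[OF that] by (auto intro: all_moments_integrable all_moments_power)
    have EA: "expectation ?A = \<mu>"
      using elim by (simp add: mean int)
    have "variance ?A = expectation (\<lambda>\<omega>. (1 / real J * (\<Sum>j=1..J. Z j \<omega> + - \<mu>))\<^sup>2)"
      unfolding EA using elim by (intro Bochner_Integration.integral_cong)
        (auto simp: sum_subtractf field_simps)
    also have "\<dots> = 1 / (real J)\<^sup>2 * expectation (\<lambda>\<omega>. (\<Sum>j=1..J. Z j \<omega> + - \<mu>)\<^sup>2)"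
      by (simp add: power_divide)
    also have "expectation (\<lambda>\<omega>. (\<Sum>j=1..J. Z j \<omega> + - \<mu>)\<^sup>2) = (\<Sum>j=1..J. expectation (\<lambda>\<omega>. (Z j \<omega> + - \<mu>)\<^sup>2))"
    proof (rule indep_centered_sum_square)
      have "indep_vars (\<lambda>_. borel) Z {1..J}"
        by (rule indep_vars_subset[OF assms(1)]) auto
      then show "indep_vars (\<lambda>_. borel) (\<lambda>j \<omega>. Z j \<omega> + - \<mu>) {1..J}"
        by (rule indep_vars_compose2) auto
    qed (use mom int in \<open>auto intro!: all_moments_add all_moments_const simp: mean prob_space
          simp del: add_uminus_conv_diff\<close>)
    also have "\<dots> = real J * (V - \<mu>\<^sup>2)"
    proof -
      have "expectation (\<lambda>\<omega>. (Z j \<omega> + - \<mu>)\<^sup>2) = V - \<mu>\<^sup>2" if "j \<ge> 1" for j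
        using variance_eq[OF int[OF that]] by (simp add: mean[OF that] second[OF that])
      then show ?thesis by simp
    qed
    finally have var: "variance ?A = (V - \<mu>\<^sup>2) / real J"
      using elim by (simp add: power2_eq_square)
    have "prob {\<omega> \<in> space M. \<epsilon> \<le> \<bar>?A \<omega> - expectation ?A\<bar>} \<le> variance ?A / \<epsilon>\<^sup>2"
      using momA \<open>\<epsilon> > 0\<close>
      by (intro Chebyshev_inequality all_moments_measurable all_moments_integrable[OF all_moments_power])
    also note var
    finally show ?case
      unfolding EA by (simp add: mult.commute)
  qed
qed

section \<open>Independence and joint laws of blocks\<close>

text \<open>Injectivity makes the singleton blocks \<open>{h i}\<close> disjoint; grouping along
  them and reading off the single coordinate gives the renamed family.\<close>

lemma (in prob_space) indep_vars_reindex: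
  assumes "indep_vars M' X I" "inj_on h L" "h ` L \<subseteq> I"
  shows "indep_vars (\<lambda>i. M' (h i)) (\<lambda>i. X (h i)) L"
proof -
  have "indep_vars (\<lambda>i. Pi\<^sub>M {h i} M') (\<lambda>i \<omega>. restrict (\<lambda>k. X k \<omega>) {h i}) L"
    using assms by (intro indep_vars_restrict[OF assms(1)])
      (auto simp: disjoint_family_on_def inj_on_def)
  then have "indep_vars (\<lambda>i. M' (h i)) (\<lambda>i \<omega>. (restrict (\<lambda>k. X k \<omega>) {h i}) (h i)) L"
    by (rule indep_vars_compose2[where Y = "\<lambda>i f. f (h i)"]) auto
  then show ?thesis by simp
qed

text \<open>Turns joint independence of all coefficients and entries into independence over the
  signals j: the blocks \<open>{j} \<times> B\<close> are disjoint, and the same measurable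
  \<open>f\<close> is applied to each.\<close>

lemma (in prob_space) indep_vars_blocks:
  fixes X :: "'j \<Rightarrow> 'i \<Rightarrow> 'a \<Rightarrow> real"
  assumes "indep_vars (\<lambda>_. borel) (\<lambda>(j, i). X j i) (L \<times> B)"
    and [measurable]: "f \<in> borel_measurable (Pi\<^sub>M B (\<lambda>_. borel))"
  shows "indep_vars (\<lambda>_. borel) (\<lambda>j \<omega>. f (\<lambda>i\<in>B. X j i \<omega>) :: real) L"
proof -
  have "indep_vars (\<lambda>j. Pi\<^sub>M ({j} \<times> B) (\<lambda>_. borel)) (\<lambda>j \<omega>. restrict (\<lambda>k. (case k of (j, i) \<Rightarrow> X j i) \<omega>) ({j} \<times> B)) L"
    by (rule indep_vars_restrict[OF assms(1)]) (auto simp: disjoint_family_on_def)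
  then have "indep_vars (\<lambda>_. borel) (\<lambda>j \<omega>. f (\<lambda>i\<in>B. (restrict (\<lambda>k. (case k of (j, i) \<Rightarrow> X j i) \<omega>) ({j} \<times> B)) (j, i))) L"
    by (rule indep_vars_compose2[where Y = "\<lambda>j v. f (\<lambda>i\<in>B. v (j, i))"]) measurable
  then show ?thesis by (simp cong: restrict_cong)
qed

text \<open>The joint law of an independent family is the product of its marginals. The product
  characterization is applied to nonempty families; for the empty one both tuples are the same
  constant.\<close>

lemma (in prob_space) distr_indep_tuple_cong:
  assumes "indep_vars N X I" "indep_vars N Y I"
    and "\<And>i. i \<in> I \<Longrightarrow> distr M (N i) (X i) = distr M (N i) (Y i)"
  shows "distr M (Pi\<^sub>M I N) (\<lambda>\<omega>. \<lambda>i\<in>I. X i \<omega>) = distr M (Pi\<^sub>M I N) (\<lambda>\<omega>. \<lambda>i\<in>I. Y i \<omega>)"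
proof (cases "I = {}")
  case False
  have "X i \<in> measurable M (N i)" "Y i \<in> measurable M (N i)" if "i \<in> I" for i
    using assms(1,2) that by (auto simp: indep_vars_def)
  then have "distr M (Pi\<^sub>M I N) (\<lambda>\<omega>. \<lambda>i\<in>I. X i \<omega>) = Pi\<^sub>M I (\<lambda>i. distr M (N i) (X i))"
    "distr M (Pi\<^sub>M I N) (\<lambda>\<omega>. \<lambda>i\<in>I. Y i \<omega>) = Pi\<^sub>M I (\<lambda>i. distr M (N i) (Y i))"
    using assms(1,2) False by (auto simp: indep_vars_iff_distr_eq_PiM'[symmetric])
  then show ?thesis
    using assms(3) by (simp cong: PiM_cong)
qed (simp add: restrict_def)

section \<open>Selection by a separating threshold\<close>

text \<open>The indices that beat a given n in \<Omega> lie in \<Omega> and omit n, so there are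
  fewer than K of them; an n outside \<Omega> is beaten by all K members. Strict separation rules
  out ties at the K-th place.\<close>

lemma trivial_pursuit_eqI:
  fixes \<Omega> :: "'n::finite set"
  assumes in_large: "\<And>n. n \<in> \<Omega> \<Longrightarrow> tp_statistic J y \<Phi> \<Psi> n > t"
    and out_small: "\<And>n. n \<notin> \<Omega> \<Longrightarrow> tp_statistic J y \<Phi> \<Psi> n < t"
  shows "trivial_pursuit (card \<Omega>) J y \<Phi> \<Psi> = \<Omega>"
proof -
  let ?\<xi> = "tp_statistic J y \<Phi> \<Psi>"
  have "card {k. ?\<xi> k > ?\<xi> n} < card \<Omega>" if "n \<in> \<Omega>" for n
  proof (rule psubset_card_mono)
    show "{k. ?\<xi> k > ?\<xi> n} \<subset> \<Omega>"
      using that in_large[OF that] out_small by (force simp: not_less)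
  qed simp
  moreover have "card \<Omega> \<le> card {k. ?\<xi> k > ?\<xi> n}" if "n \<notin> \<Omega>" for n
    using out_small[OF that] in_large by (intro card_mono) force+
  ultimately show ?thesis
    unfolding trivial_pursuit_def by (auto simp: not_le[symmetric])
qed

section \<open>Correlations and their second moments\<close>

text \<open>The inner product of columns l and n of \<Phi>\<Psi>, as a function of the family of
  entries of \<Phi>, so that independence of families of variables applies to it.\<close>

definition gram_coeff :: "real ^ 'n ^ 'n \<Rightarrow> 'n \<Rightarrow> 'n \<Rightarrow> ('m \<times> 'n \<Rightarrow> real) \<Rightarrow> real" where
  "gram_coeff \<Psi> l n \<phi> = (\<Sum>m\<in>UNIV. (\<Sum>p\<in>UNIV. \<Psi> $ p $ l * \<phi> (m, p)) * (\<Sum>p\<in>UNIV. \<Psi> $ p $ n * \<phi> (m, p)))"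

text \<open>The inner product of y with column n of \<Phi>\<Psi>, as a function of one family: left
  indices carry the coefficients, right indices the matrix entries.\<close>

definition correlation :: "real ^ 'n ^ 'n \<Rightarrow> 'n set \<Rightarrow> 'n \<Rightarrow> ('n + 'm \<times> 'n \<Rightarrow> real) \<Rightarrow> real" where
  "correlation \<Psi> \<Omega> n v = (\<Sum>l\<in>\<Omega>. v (Inl l) * gram_coeff \<Psi> l n (\<lambda>i. v (Inr i)))"

text \<open>The measurement is the combination of the columns of \<Phi>\<Psi> weighted by \<theta>,
  and the support condition cuts the sum down to \<Omega>.\<close>

lemma inner_column_eq_correlation:
  fixes \<Psi> :: "real ^ 'n ^ 'n" and \<Phi> :: "real ^ 'n ^ 'm"
  assumes "\<And>n. n \<notin> \<Omega> \<Longrightarrow> \<theta> $ n = 0"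
  shows "(\<Phi> *v (\<Psi> *v \<theta>)) \<bullet> column n (\<Phi> ** \<Psi>) =
    correlation \<Psi> \<Omega> n (case_sum (\<lambda>l. \<theta> $ l) (\<lambda>(m, p). \<Phi> $ m $ p))"
proof -
  have "(\<Phi> *v (\<Psi> *v \<theta>)) \<bullet> column n (\<Phi> ** \<Psi>) =
      (\<Sum>m\<in>UNIV. \<Sum>l\<in>UNIV. \<theta> $ l * ((\<Phi> ** \<Psi>) $ m $ l * (\<Phi> ** \<Psi>) $ m $ n))"
    unfolding matrix_vector_mul_assoc
    by (simp add: inner_vec_def column_def matrix_vector_mult_def sum_distrib_left sum_distrib_right mult_ac)
  also have "\<dots> = (\<Sum>l\<in>UNIV. \<theta> $ l * (\<Sum>m\<in>UNIV. (\<Phi> ** \<Psi>) $ m $ l * (\<Phi> ** \<Psi>) $ m $ n))"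
    by (subst sum.swap) (simp add: sum_distrib_left)
  also have "\<dots> = (\<Sum>l\<in>\<Omega>. \<theta> $ l * (\<Sum>m\<in>UNIV. (\<Phi> ** \<Psi>) $ m $ l * (\<Phi> ** \<Psi>) $ m $ n))"
    using assms by (intro sum.mono_neutral_right) auto
  finally show ?thesis
    by (simp add: correlation_def gram_coeff_def matrix_matrix_mult_def mult.commute)
qed

lemma correlation_restrict:
  "correlation \<Psi> \<Omega> n (restrict v (\<Omega> <+> UNIV)) = correlation \<Psi> \<Omega> n v"
  unfolding correlation_def by (intro sum.cong) (auto simp: InlI InrI)

lemma measurable_correlation:
  "correlation \<Psi> \<Omega> n \<in> borel_measurable (Pi\<^sub>M (\<Omega> <+> UNIV) (\<lambda>_. borel))"
  unfolding correlation_def[abs_def] gram_coeff_def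
  by (intro borel_measurable_sum borel_measurable_times measurable_const measurable_component_singleton) auto

text \<open>The square expands over pairs of rows m, m' into products of four linear forms in the
  entries, to which Wick's formula applies.\<close>

lemma (in prob_space) expectation_gram_coeff_square:
  fixes \<Psi> :: "real ^ 'n ^ 'n" and \<phi> :: "'m::finite \<times> 'n \<Rightarrow> 'a \<Rightarrow> real"
  assumes "orthonormal_basis_matrix \<Psi>" "\<tau> > 0"
    and "indep_vars (\<lambda>_. borel) \<phi> UNIV"
    and "\<And>i. distributed M lborel (\<phi> i) (\<lambda>t. ennreal (normal_density 0 \<tau> t))"
  shows "expectation (\<lambda>\<omega>. (gram_coeff \<Psi> l n (\<lambda>i. \<phi> i \<omega>))\<^sup>2) =
    \<tau> ^ 4 * (CARD('m) + (if l = n then CARD('m) * (CARD('m) + 1) else 0))"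
proof -
  \<comment> \<open>Column l of \<Psi> placed in row m of an otherwise zero matrix. Orthonormality
    of the columns makes these vectors orthonormal (\<open>ip_u\<close>).\<close>
  define u :: "'m \<Rightarrow> 'n \<Rightarrow> 'm \<times> 'n \<Rightarrow> real" where "u m l = (\<lambda>(m', p). if m' = m then \<Psi> $ p $ l else 0)" for m l
  define L where "L v \<omega> = (\<Sum>i\<in>UNIV. v i * \<phi> i \<omega>)" for v \<omega>
  have L_u: "L (u m l) \<omega> = (\<Sum>p\<in>UNIV. \<Psi> $ p $ l * \<phi> (m, p) \<omega>)" for m l \<omega>
  proof -
    have "L (u m l) \<omega> = (\<Sum>m'\<in>UNIV. \<Sum>p\<in>UNIV. u m l (m', p) * \<phi> (m', p) \<omega>)"
      unfolding L_def UNIV_Times_UNIV[symmetric] sum.cartesian_product' ..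
    also have "\<dots> = (\<Sum>m'\<in>UNIV. if m' = m then \<Sum>p\<in>UNIV. \<Psi> $ p $ l * \<phi> (m, p) \<omega> else 0)"
      by (intro sum.cong) (auto simp: u_def)
    finally show ?thesis by simp
  qed
  have ip_u: "(\<Sum>i\<in>UNIV. u m l i * u m' l' i) = (if m = m' \<and> l = l' then 1 else 0)" for m l m' l'
  proof -
    have "column l \<Psi> \<bullet> column l' \<Psi> = (if l = l' then 1 else 0)"
      using assms(1) by (auto simp: orthonormal_basis_matrix_def)
    then have "(\<Sum>p\<in>UNIV. \<Psi> $ p $ l * \<Psi> $ p $ l') = (if l = l' then 1 else 0)"
      by (simp add: inner_vec_def column_def)
    moreover have "(\<Sum>i\<in>UNIV. u m l i * u m' l' i) = (\<Sum>k\<in>UNIV. \<Sum>p\<in>UNIV. u m l (k, p) * u m' l' (k, p))"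
      unfolding UNIV_Times_UNIV[symmetric] sum.cartesian_product' ..
    moreover have "\<dots> = (\<Sum>k\<in>UNIV. if k = m then if m = m' then \<Sum>p\<in>UNIV. \<Psi> $ p $ l * \<Psi> $ p $ l' else 0 else 0)"
      by (intro sum.cong) (auto simp: u_def)
    ultimately show ?thesis by (simp split: if_splits)
  qed
  have mom: "all_moments M (L v)" for v
    unfolding L_def using normal_all_moments[OF assms(2,4)]
    by (intro all_moments_sum all_moments_cmult)
  have "expectation (\<lambda>\<omega>. (gram_coeff \<Psi> l n (\<lambda>i. \<phi> i \<omega>))\<^sup>2) =
      expectation (\<lambda>\<omega>. \<Sum>m\<in>UNIV. \<Sum>m'\<in>UNIV. L (u m l) \<omega> * L (u m n) \<omega> * L (u m' l) \<omega> * L (u m' n) \<omega>)"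
    by (simp add: gram_coeff_def L_u[symmetric] power2_eq_square sum_product mult.assoc)
  also have "\<dots> = (\<Sum>m\<in>UNIV. \<Sum>m'\<in>UNIV. expectation (\<lambda>\<omega>. L (u m l) \<omega> * L (u m n) \<omega> * L (u m' l) \<omega> * L (u m' n) \<omega>))"
    using mom by (simp add: Bochner_Integration.integral_sum all_moments_integrable all_moments_mult all_moments_sum)
  \<comment> \<open>The three summands are the three pairings. Summed over m and m' they contribute
    M^2 [l = n], M and M [l = n].\<close>
  also have "\<dots> = (\<Sum>m\<in>UNIV. \<Sum>m'\<in>(UNIV :: 'm set). \<tau> ^ 4 * ((if l = n then 1 else 0) + (if m = m' then 1 else 0) + (if m = m' \<and> l = n then 1 else 0)))"
    unfolding L_def gaussian_wick4[OF finite assms(3,2,4)] ip_u by (intro sum.cong) auto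
  also have "\<dots> = \<tau> ^ 4 * (CARD('m) + (if l = n then CARD('m) * (CARD('m) + 1) else 0))"
    by (cases "l = n") (simp_all add: sum_distrib_left[symmetric] sum.distrib distrib_left)
  finally show ?thesis .
qed

lemma (in prob_space) correlation_all_moments:
  assumes "\<And>i. i \<in> \<Omega> <+> UNIV \<Longrightarrow> all_moments M (X i)"
  shows "all_moments M (\<lambda>\<omega>. correlation \<Psi> \<Omega> n (\<lambda>i. X i \<omega>))"
  unfolding correlation_def gram_coeff_def using assms
  by (intro all_moments_sum all_moments_mult all_moments_const) auto

text \<open>Independence separates coefficients from matrix entries, and uncorrelated coefficients
  leave only the diagonal l = l'. The extra M (M + 1) appears once, from l = n, exactly when n lies
  in \<Omega>.\<close>

lemma (in prob_space) expectation_correlation_square: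
  fixes \<Psi> :: "real ^ 'n ^ 'n" and X :: "'n + 'm::finite \<times> 'n \<Rightarrow> 'a \<Rightarrow> real"
  assumes \<Psi>: "orthonormal_basis_matrix \<Psi>" and "\<sigma> > 0" "\<tau> > 0"
    and ind: "indep_vars (\<lambda>_. borel) X (\<Omega> <+> UNIV)"
    and coef: "\<And>l. l \<in> \<Omega> \<Longrightarrow> distributed M lborel (X (Inl l)) (\<lambda>t. ennreal (normal_density 0 \<sigma> t))"
    and entry: "\<And>i. distributed M lborel (X (Inr i)) (\<lambda>t. ennreal (normal_density 0 \<tau> t))"
  shows "expectation (\<lambda>\<omega>. (correlation \<Psi> \<Omega> n (\<lambda>i. X i \<omega>))\<^sup>2) =
    \<sigma>\<^sup>2 * \<tau> ^ 4 * (CARD('m) * card \<Omega> + (if n \<in> \<Omega> then CARD('m) * (CARD('m) + 1) else 0))"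
proof -
  let ?G = "\<lambda>l \<omega>. gram_coeff \<Psi> l n (\<lambda>i. X (Inr i) \<omega>)"
  have indG: "indep_vars (\<lambda>_. borel) (\<lambda>i. X (Inr i)) UNIV"
    by (rule indep_vars_reindex[OF ind]) auto
  have momX: "all_moments M (X (Inr i))" for i
    by (rule normal_all_moments[OF \<open>\<tau> > 0\<close> entry])
  have momG: "all_moments M (?G l)" for l
    unfolding gram_coeff_def
    by (intro all_moments_sum all_moments_mult all_moments_const momX)
  have mom: "all_moments M (X (Inl l))" if "l \<in> \<Omega>" for l
    by (rule normal_all_moments[OF \<open>\<sigma> > 0\<close> coef[OF that]])
  have coef_prod: "expectation (\<lambda>\<omega>. X (Inl l) \<omega> * X (Inl l') \<omega>) = (if l = l' then \<sigma>\<^sup>2 else 0)"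
    if l: "l \<in> \<Omega>" "l' \<in> \<Omega>" for l l'
  proof (cases "l = l'")
    case True
    then show ?thesis
      using normal_moments(2)[OF \<open>\<sigma> > 0\<close> coef[OF l(1)]] by (simp add: power2_eq_square)
  next
    case False
    \<comment> \<open>Independence of the two coefficients is read off \<open>indep_vars_sum\<close>
      with a one-element sum.\<close>
    have "indep_vars (\<lambda>_. borel) X (insert (Inl l) {Inl l'})"
      using l by (intro indep_vars_subset[OF ind]) auto
    from indep_vars_sum[OF _ _ this] False
    have "indep_var borel (X (Inl l)) borel (X (Inl l'))" by simp
    from expectation_power_mult_indep[OF this mom mom, of 1 1] False l
    show ?thesis
      by (simp add: normal_moments(1)[OF \<open>\<sigma> > 0\<close> coef])
  qed
  have split: "expectation (\<lambda>\<omega>. (X (Inl l) \<omega> * X (Inl l') \<omega>) * (?G l \<omega> * ?G l' \<omega>)) =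
      expectation (\<lambda>\<omega>. X (Inl l) \<omega> * X (Inl l') \<omega>) * expectation (\<lambda>\<omega>. ?G l \<omega> * ?G l' \<omega>)"
    if l: "l \<in> \<Omega>" "l' \<in> \<Omega>" for l l'
  proof (rule indep_var_lebesgue_integral)
    let ?R = "\<lambda>A \<omega>. restrict (\<lambda>i. X i \<omega>) A"
    let ?A = "Inl ` \<Omega> :: ('n + 'm \<times> 'n) set" and ?B = "range Inr :: ('n + 'm \<times> 'n) set"
    have "indep_var (Pi\<^sub>M ?A (\<lambda>_. borel)) (?R ?A) (Pi\<^sub>M ?B (\<lambda>_. borel)) (?R ?B)"
      by (rule indep_var_restrict[OF ind]) auto
    then have "indep_var borel ((\<lambda>v. v (Inl l) * v (Inl l')) \<circ> ?R ?A)
        borel ((\<lambda>v. gram_coeff \<Psi> l n (\<lambda>i. v (Inr i)) * gram_coeff \<Psi> l' n (\<lambda>i. v (Inr i))) \<circ> ?R ?B)"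
      unfolding gram_coeff_def using l
      by (intro indep_var_compose borel_measurable_sum borel_measurable_times measurable_const
          measurable_component_singleton) auto
    then show "indep_var borel (\<lambda>\<omega>. X (Inl l) \<omega> * X (Inl l') \<omega>) borel (\<lambda>\<omega>. ?G l \<omega> * ?G l' \<omega>)"
      using l by (simp add: comp_def)
  qed (use l mom momG in \<open>auto intro!: all_moments_integrable all_moments_mult\<close>)
  have "expectation (\<lambda>\<omega>. (correlation \<Psi> \<Omega> n (\<lambda>i. X i \<omega>))\<^sup>2) =
      expectation (\<lambda>\<omega>. \<Sum>l\<in>\<Omega>. \<Sum>l'\<in>\<Omega>. (X (Inl l) \<omega> * X (Inl l') \<omega>) * (?G l \<omega> * ?G l' \<omega>))"
    by (simp add: correlation_def power2_eq_square sum_product mult_ac)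
  also have "\<dots> = (\<Sum>l\<in>\<Omega>. \<Sum>l'\<in>\<Omega>. expectation (\<lambda>\<omega>. (X (Inl l) \<omega> * X (Inl l') \<omega>) * (?G l \<omega> * ?G l' \<omega>)))"
    using mom momG
    by (simp add: Bochner_Integration.integral_sum all_moments_integrable all_moments_mult all_moments_sum)
  also have "\<dots> = (\<Sum>l\<in>\<Omega>. \<Sum>l'\<in>\<Omega>. if l = l' then \<sigma>\<^sup>2 * expectation (\<lambda>\<omega>. (?G l \<omega>)\<^sup>2) else 0)"
    by (intro sum.cong refl) (simp add: split coef_prod power2_eq_square)
  also have "\<dots> = (\<Sum>l\<in>\<Omega>. \<sigma>\<^sup>2 * (\<tau> ^ 4 * (CARD('m) + (if l = n then CARD('m) * (CARD('m) + 1) else 0))))"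
    by (simp add: expectation_gram_coeff_square[OF \<Psi> \<open>\<tau> > 0\<close> indG entry])
  also have "\<dots> = \<sigma>\<^sup>2 * \<tau> ^ 4 * (CARD('m) * card \<Omega> + (if n \<in> \<Omega> then CARD('m) * (CARD('m) + 1) else 0))"
    by (simp add: sum_distrib_left[symmetric] sum.distrib mult.assoc if_distrib[of real] cong: if_cong)
  finally show ?thesis .
qed

(* The last assumption on the random variables is the joint independence of all coefficients
   on the support and all matrix entries: the coefficients are independent over (j, n), the
   entries of each matrix are independent, the matrices are independent over j, and they
   are independent of the signals. The variances are \<sigma>^2 and \<tau>^2. *)
theorem theorem7:
  fixes P :: "'a measure"
    and \<Psi> :: "real ^ 'n ^ 'n"
    and \<Omega> :: "'n set"
    and K :: nat
    and \<sigma> \<tau> :: real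
    and \<theta> x :: "nat \<Rightarrow> 'a \<Rightarrow> real ^ 'n"
    and \<Phi> :: "nat \<Rightarrow> 'a \<Rightarrow> real ^ 'n ^ 'm"
    and y :: "nat \<Rightarrow> 'a \<Rightarrow> real ^ 'm"
  assumes "prob_space P"
    and "orthonormal_basis_matrix \<Psi>"
    and "card \<Omega> = K"
    and "\<sigma> > 0" and "\<tau> > 0"
    and "\<And>j \<omega> n. j \<ge> 1 \<Longrightarrow> \<omega> \<in> space P \<Longrightarrow> n \<notin> \<Omega> \<Longrightarrow> \<theta> j \<omega> $ n = 0"
    and "\<And>j n. j \<ge> 1 \<Longrightarrow> n \<in> \<Omega> \<Longrightarrow>
           distributed P lborel (\<lambda>\<omega>. \<theta> j \<omega> $ n) (\<lambda>t. ennreal (normal_density 0 \<sigma> t))"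
    and "\<And>j m n. j \<ge> 1 \<Longrightarrow>
           distributed P lborel (\<lambda>\<omega>. \<Phi> j \<omega> $ m $ n) (\<lambda>t. ennreal (normal_density 0 \<tau> t))"
    and "prob_space.indep_vars P (\<lambda>_. borel)
           (\<lambda>i \<omega>. case i of Inl (j, n) \<Rightarrow> \<theta> j \<omega> $ n | Inr (j, m, n) \<Rightarrow> \<Phi> j \<omega> $ m $ n)
           (({1..} \<times> \<Omega>) <+> ({1..} \<times> (UNIV :: 'm set) \<times> (UNIV :: 'n set)))"
    and "\<And>j \<omega>. j \<ge> 1 \<Longrightarrow> \<omega> \<in> space P \<Longrightarrow> x j \<omega> = \<Psi> *v \<theta> j \<omega>"
    and "\<And>j \<omega>. j \<ge> 1 \<Longrightarrow> \<omega> \<in> space P \<Longrightarrow> y j \<omega> = \<Phi> j \<omega> *v x j \<omega>"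
  shows "(\<lambda>J. measure P {\<omega> \<in> space P.
            trivial_pursuit K J (\<lambda>j. y j \<omega>) (\<lambda>j. \<Phi> j \<omega>) \<Psi> = \<Omega>}) \<longlonglongrightarrow> 1"
proof -
  interpret prob_space P by fact
  note orth = assms(2) and card = assms(3) and \<sigma> = assms(4) and \<tau> = assms(5) and supp = assms(6)
    and coef = assms(7) and entry = assms(8) and ind = assms(9) and x = assms(10) and y = assms(11)
  let ?B = "\<Omega> <+> (UNIV :: ('m \<times> 'n) set)"
  \<comment> \<open>One family per signal over the index set \<open>?B\<close>, which is the same
    for every j, so that signals can be compared as blocks.\<close>
  define X where "X j = case_sum (\<lambda>l \<omega>. \<theta> j \<omega> $ l) (\<lambda>(m, p) \<omega>. \<Phi> j \<omega> $ m $ p)" for j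
  define Z where "Z n j \<omega> = (correlation \<Psi> \<Omega> n (\<lambda>i. X j i \<omega>))\<^sup>2" for n j \<omega>
  define b where "b = \<sigma>\<^sup>2 * \<tau> ^ 4 * (CARD('m) * card \<Omega>)"
  \<comment> \<open>Half the gap between the two possible means, so \<open>b + \<epsilon>\<close>
    lies midway. It is positive because \<open>CARD('m)\<close> is: a finite index type is nonempty,
    which encodes M >= 1.\<close>
  define \<epsilon> where "\<epsilon> = \<sigma>\<^sup>2 * \<tau> ^ 4 * (CARD('m) * (CARD('m) + 1)) / 2"
  define \<mu> where "\<mu> n = (if n \<in> \<Omega> then b + 2 * \<epsilon> else b)" for n
  have \<epsilon>: "\<epsilon> > 0"
    using \<sigma> \<tau> by (simp add: \<epsilon>_def zero_less_mult_iff add_pos_nonneg)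

  have coefX: "distributed P lborel (X j (Inl l)) (\<lambda>t. ennreal (normal_density 0 \<sigma> t))"
    if "j \<ge> 1" "l \<in> \<Omega>" for j l
    using coef[OF that] by (simp add: X_def)
  have entryX: "distributed P lborel (X j (Inr i)) (\<lambda>t. ennreal (normal_density 0 \<tau> t))"
    if "j \<ge> 1" for j i
    using entry[OF that, of "fst i" "snd i"] by (simp add: X_def split_beta)
  \<comment> \<open>Translates a pair of signal and block index into the sum-typed index of the
    independence hypothesis.\<close>
  define h :: "nat \<times> ('n + 'm \<times> 'n) \<Rightarrow> (nat \<times> 'n) + (nat \<times> 'm \<times> 'n)" where
    "h = (\<lambda>(j, i). case_sum (\<lambda>l. Inl (j, l)) (\<lambda>i. Inr (j, i)) i)"
  have indX: "indep_vars (\<lambda>_. borel) (\<lambda>(j, i). X j i) ({1..} \<times> ?B)"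
  proof -
    have "inj_on h ({1..} \<times> ?B)" "h ` ({1..} \<times> ?B) \<subseteq> ({1..} \<times> \<Omega>) <+> ({1..} \<times> UNIV \<times> UNIV)"
      by (auto simp: h_def inj_on_def split: sum.splits)
    from indep_vars_reindex[OF ind this] show ?thesis
      by (rule indep_vars_cong[THEN iffD1, rotated -1])
        (auto simp: h_def X_def split: sum.splits)
  qed
  have ind_block: "indep_vars (\<lambda>_. borel) (X j) ?B" if "j \<ge> 1" for j
    using indep_vars_reindex[OF indX, of "Pair j" ?B] that by (auto simp: inj_on_def)
  have momX: "all_moments P (X j i)" if "j \<ge> 1" "i \<in> ?B" for j i
    using that(2) normal_all_moments[OF \<sigma> coefX[OF that(1)]] normal_all_moments[OF \<tau> entryX[OF that(1)]]
    by auto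
  have momZ: "all_moments P (Z n j)" if "j \<ge> 1" for n j
    unfolding Z_def using momX[OF that] by (intro all_moments_power correlation_all_moments)
  have meanZ: "expectation (Z n j) = \<mu> n" if "j \<ge> 1" for n j
    unfolding Z_def
    by (subst expectation_correlation_square[OF orth \<sigma> \<tau> ind_block coefX entryX])
      (use that in \<open>auto simp: \<mu>_def b_def \<epsilon>_def algebra_simps\<close>)

  have tuple: "(\<lambda>\<omega>. \<lambda>i\<in>?B. X j i \<omega>) \<in> measurable P (Pi\<^sub>M ?B (\<lambda>_. borel))" if "j \<ge> 1" for j
    using momX[OF that] by (intro measurable_restrict all_moments_measurable)
  have Z_tuple: "Z n j \<omega> = (correlation \<Psi> \<Omega> n (\<lambda>i\<in>?B. X j i \<omega>))\<^sup>2" for n j \<omega>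
    by (simp add: Z_def correlation_restrict)
  have indZ: "indep_vars (\<lambda>_. borel) (Z n) {1..}" for n
    unfolding Z_tuple[abs_def]
    by (rule indep_vars_blocks[OF indX, of "\<lambda>v. (correlation \<Psi> \<Omega> n v)\<^sup>2"])
      (intro borel_measurable_power measurable_correlation)
  \<comment> \<open>The weak law needs only a common value, not an explicit one. The blocks have
    equal joint laws, so the value at j = 1 serves for all j.\<close>
  have secondZ: "expectation (\<lambda>\<omega>. (Z n j \<omega>)\<^sup>2) = expectation (\<lambda>\<omega>. (Z n 1 \<omega>)\<^sup>2)" if "j \<ge> 1" for n j
  proof -
    have law: "distr P borel (X j i) = distr P borel (X 1 i)" if "i \<in> ?B" for i
    proof (cases i)
      case (Inl l)
      then show ?thesis
        using that \<open>j \<ge> 1\<close> distributed_distr_eq_density[OF coefX[of _ l]]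
        by (auto simp: distr_cong[OF refl sets_lborel])
    next
      case (Inr k)
      then show ?thesis
        using that \<open>j \<ge> 1\<close> distributed_distr_eq_density[OF entryX[of _ k]]
        by (auto simp: distr_cong[OF refl sets_lborel])
    qed
    have "expectation (\<lambda>\<omega>. (Z n j \<omega>)\<^sup>2) =
        (\<integral>v. ((correlation \<Psi> \<Omega> n v)\<^sup>2)\<^sup>2 \<partial>distr P (Pi\<^sub>M ?B (\<lambda>_. borel)) (\<lambda>\<omega>. \<lambda>i\<in>?B. X j i \<omega>))" if "j \<ge> 1" for j
      unfolding Z_tuple
      by (subst integral_distr[OF tuple[OF that]]) (intro borel_measurable_power measurable_correlation refl)+
    then show ?thesis
      using distr_indep_tuple_cong[OF ind_block[OF that] ind_block[of 1] law] that by simp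
  qed

  let ?\<xi> = "\<lambda>J \<omega>. tp_statistic J (\<lambda>j. y j \<omega>) (\<lambda>j. \<Phi> j \<omega>) \<Psi>"
  \<comment> \<open>Restricted to the sample space, where the support condition and the equations
    for x and y are assumed.\<close>
  have stat: "?\<xi> J \<omega> n = 1 / real J * (\<Sum>j=1..J. Z n j \<omega>)" if "\<omega> \<in> space P" for J \<omega> n
  proof -
    have "(\<lambda>i. X j i \<omega>) = case_sum (\<lambda>l. \<theta> j \<omega> $ l) (\<lambda>(m, p). \<Phi> j \<omega> $ m $ p)" for j
      by (auto simp: X_def fun_eq_iff split: sum.split)
    then have "(y j \<omega> \<bullet> column n (\<Phi> j \<omega> ** \<Psi>))\<^sup>2 = Z n j \<omega>" if "j \<ge> 1" for j
      using inner_column_eq_correlation[of \<Omega> "\<theta> j \<omega>" "\<Phi> j \<omega>", OF supp] that \<open>\<omega> \<in> space P\<close>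
      by (simp add: Z_def x y)
    then show ?thesis
      by (simp add: tp_statistic_def)
  qed
  have stat_measurable [measurable]: "(\<lambda>\<omega>. ?\<xi> J \<omega> n) \<in> borel_measurable P" for J n
    using all_moments_measurable[OF momZ]
    by (subst measurable_cong[OF stat]) (auto intro!: borel_measurable_times borel_measurable_sum)
  define Bad where "Bad J n = {\<omega> \<in> space P. \<epsilon> \<le> \<bar>?\<xi> J \<omega> n - \<mu> n\<bar>}" for J n
  have Bad_sets: "Bad J n \<in> events" for J n
    unfolding Bad_def by measurable
  have Bad_lim: "(\<lambda>J. prob (Bad J n)) \<longlonglongrightarrow> 0" for n
  proof -
    have "Bad J n = {\<omega> \<in> space P. \<epsilon> \<le> \<bar>1 / real J * (\<Sum>j=1..J. Z n j \<omega>) - \<mu> n\<bar>}" for J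
      unfolding Bad_def using stat by auto
    then show ?thesis
      using weak_law_of_large_numbers[OF indZ momZ meanZ secondZ \<epsilon>] by simp
  qed
  let ?Good = "\<lambda>J. {\<omega> \<in> space P. trivial_pursuit K J (\<lambda>j. y j \<omega>) (\<lambda>j. \<Phi> j \<omega>) \<Psi> = \<Omega>}"
  have Good_sets: "?Good J \<in> events" for J
  proof -
    \<comment> \<open>The cardinality becomes a finite sum of indicators, whose measurability
      follows from that of the statistics.\<close>
    have "real (card {k. ?\<xi> J \<omega> k > ?\<xi> J \<omega> n}) = (\<Sum>k\<in>UNIV. if ?\<xi> J \<omega> k > ?\<xi> J \<omega> n then 1 else 0)" for \<omega> n
      by (simp add: sum.If_cases)
    then have "?Good J = {\<omega> \<in> space P. \<forall>n\<in>UNIV. (\<Sum>k\<in>UNIV. if ?\<xi> J \<omega> k > ?\<xi> J \<omega> n then 1 else 0 :: real) < real K \<longleftrightarrow> n \<in> \<Omega>}"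
      unfolding trivial_pursuit_def set_eq_iff by (simp flip: of_nat_less_iff[where 'a=real])
    also have "\<dots> \<in> events"
      by measurable
    finally show ?thesis .
  qed
  have Good: "space P - (\<Union>n. Bad J n) \<subseteq> ?Good J" for J
  proof
    fix \<omega> assume \<omega>: "\<omega> \<in> space P - (\<Union>n. Bad J n)"
    then have "\<bar>?\<xi> J \<omega> n - \<mu> n\<bar> < \<epsilon>" for n
      by (auto simp: Bad_def not_le)
    then have near: "\<mu> n - \<epsilon> < ?\<xi> J \<omega> n \<and> ?\<xi> J \<omega> n < \<mu> n + \<epsilon>" for n
      by (simp add: abs_less_iff) (smt (verit, best))
    have "trivial_pursuit (card \<Omega>) J (\<lambda>j. y j \<omega>) (\<lambda>j. \<Phi> j \<omega>) \<Psi> = \<Omega>"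
    proof (rule trivial_pursuit_eqI[of _ "b + \<epsilon>"])
      show "b + \<epsilon> < ?\<xi> J \<omega> n" if "n \<in> \<Omega>" for n
        using near[of n] that by (simp add: \<mu>_def)
      show "?\<xi> J \<omega> n < b + \<epsilon>" if "n \<notin> \<Omega>" for n
        using near[of n] that by (simp add: \<mu>_def)
    qed
    then show "\<omega> \<in> ?Good J"
      using \<omega> card by simp
  qed
  have lower: "1 - (\<Sum>n\<in>UNIV. prob (Bad J n)) \<le> prob (?Good J)" for J
  proof -
    \<comment> \<open>Union bound over the N indices; N is fixed, so the total still tends to
      0.\<close>
    have "1 - (\<Sum>n\<in>UNIV. prob (Bad J n)) \<le> 1 - prob (\<Union>n. Bad J n)"
      using finite_measure_subadditive_finite[of UNIV "Bad J"] Bad_sets by auto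
    also have "\<dots> = prob (space P - (\<Union>n. Bad J n))"
      using Bad_sets by (subst prob_compl) auto
    also have "\<dots> \<le> prob (?Good J)"
      by (rule finite_measure_mono[OF Good Good_sets])
    finally show ?thesis .
  qed
  show ?thesis
  proof (rule tendsto_sandwich[OF _ _ _ tendsto_const])
    show "(\<lambda>J. 1 - (\<Sum>n\<in>UNIV. prob (Bad J n))) \<longlonglongrightarrow> 1"
      using tendsto_diff[OF tendsto_const[of 1] tendsto_sum[of UNIV "\<lambda>n J. prob (Bad J n)" "\<lambda>_. 0"]] Bad_lim
      by simp
  qed (use lower in auto)
qed

end
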